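(* If $T$ is a tree with $n$ vertices, then $$\mathcal{P}(T)\le \mathcal{P}(S_n)\qquad\text{and}\qquad \mathcal{Q}(T)\le \mathcal{Q}(S_n),$$ where $S_n$ is the star graph on $n$ vertices and $\mathcal{P}$, $\mathcal{Q}$ are the winning probabilities of an optimal player moving first, respectively second, in the tree search game against a uniformly random opponent.
   Context: A tree is a connected acyclic undirected graph with a finite, positive number of vertices; $|T|$ is the number of vertices of $T$; $T\smallsetminus v$ is the forest obtained by deleting $v$ and its incident edges. $S_n$ is the star graph on $n$ vertices (a center adjacent to $n-1$ leaves; $S_1$ is a single vertex and $S_2$ a single edge). Tree search game on $T$: one vertex of $T$ is selected uniformly at random as the target, unknown to both players. The players alternately guess vertices. If the guess $v$ is the target, the player who made it wins. Otherwise both players are informed which component of $T\smallsetminus v$ contains the target, and the game continues on that component with the other player to move. Here one player plays to maximize their probability of winning, while the opponent always guesses a vertex uniformly at random from among the vertices that could still be the target. $\mathcal{P}(T)$ (resp. $\mathcal{Q}(T)$) is the probability that the optimal player wins when the optimal player moves first (resp. second) on $T$. Equivalently, with $n=|T|$, they are determined recursively by $$\mathcal{P}(T)=\max_{v\in V(T)}\Bigl(\frac1n+\frac1n\sum_{T'}|T'|\,\mathcal{Q}(T')\Bigr),\qquad \mathcal{Q}(T)=\frac1{n^2}\sum_{v\in V(T)}\sum_{T'}|T'|\,\mathcal{P}(T'),$$ where $T'$ ranges over the components of $T\smallsetminus v$ (empty sums are $0$). *)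

theory Defs
  imports "HOL-Probability.Probability_Mass_Function" "Graph_Theory.Digraph_Component"
begin

text \<open>
  As in \<^theory>\<open>Graph_Theory.Digraph\<close>, a finite simple undirected graph is a finite symmetric
  digraph without loops and parallel arcs (locale \<^locale>\<open>graph\<close>). The constant
  \<^const>\<open>tree\<close> of that library is not suitable here: for it the closed walk \<open>u, v, u\<close> along an
  undirected edge is a cycle, so no symmetric digraph with an edge would be a tree. The cycles
  of the underlying undirected graph are the directed cycles of length at least 3.
\<close>

definition undirected_tree :: "('a, 'b) pre_digraph \<Rightarrow> bool" where
  "undirected_tree T \<longleftrightarrow> graph T \<and> Digraph_Component.connected T \<and>
     \<not> (\<exists>p. pre_digraph.cycle T p \<and> length p \<ge> 3)"

definition star :: "nat \<Rightarrow> (nat, nat \<times> nat) pre_digraph" where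
  "star n = \<lparr>verts = {..<n}, arcs = {0} \<times> {1..<n} \<union> {1..<n} \<times> {0}, tail = fst, head = snd\<rparr>"

text \<open>
  The component of \<open>G\<close> that contains the vertex \<open>t\<close>; in a symmetric digraph the strongly
  connected components are the components of the undirected graph.
\<close>

definition component :: "('a, 'b) pre_digraph \<Rightarrow> 'a \<Rightarrow> ('a, 'b) pre_digraph" where
  "component G t = induce_subgraph G (pre_digraph.scc_of G t)"

text \<open>
  A strategy of the optimal player sees the list of all earlier guesses (of both players) and the
  tree on which the game is currently played, and returns the next guess. It never sees the target.
\<close>

type_synonym ('a, 'b) strategy = "'a list \<Rightarrow> ('a, 'b) pre_digraph \<Rightarrow> 'a"

definition strategies :: "('a, 'b) strategy set" where
  "strategies = {\<sigma>. \<forall>h G. verts G \<noteq> {} \<longrightarrow> \<sigma> h G \<in> verts G}"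

text \<open>
  The outcome (\<^const>\<open>True\<close> iff the player with strategy \<open>\<sigma>\<close> wins) of the game on \<open>G\<close> with target
  \<open>t\<close> after the guesses \<open>h\<close>; the flag \<open>me\<close> says that this player moves next. Cases
  that cannot occur in a play (\<open>G\<close> infinite, or a guess outside \<open>G\<close>) have outcome \<^const>\<open>False\<close>;
  they are singled out only to obtain a terminating recursion.
\<close>

function play :: "('a, 'b) strategy \<Rightarrow> bool \<Rightarrow> 'a list \<Rightarrow> ('a, 'b) pre_digraph \<Rightarrow> 'a \<Rightarrow> bool pmf" where
  "play \<sigma> me h G t =
     bind_pmf (if me then return_pmf (\<sigma> h G) else pmf_of_set (verts G))
       (\<lambda>v. if infinite (verts G) \<or> v \<notin> verts G then return_pmf False
            else if v = t then return_pmf me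
            else play \<sigma> (\<not> me) (h @ [v]) (component (pre_digraph.del_vert G v) t) t)"
  by pat_completeness auto

lemma verts_component_subset: "verts (component G t) \<subseteq> verts G"
  by (auto simp: component_def pre_digraph.scc_of_def elim: reachable_in_vertsE)

termination
proof (relation "Wellfounded.measure (\<lambda>(_, _, _, G, _). card (verts G))")
  fix h :: "'a list" and G :: "('a, 'b) pre_digraph" and t v :: 'a and \<sigma> :: "('a, 'b) strategy" and me
  assume "\<not> (infinite (verts G) \<or> v \<notin> verts G)"
  moreover have "verts (component (pre_digraph.del_vert G v) t) \<subseteq> verts G - {v}"
    using verts_component_subset[of "pre_digraph.del_vert G v"] by (simp add: pre_digraph.verts_del_vert)
  ultimately have "card (verts (component (pre_digraph.del_vert G v) t)) < card (verts G)"
    by (intro psubset_card_mono) auto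
  then show "((\<sigma>, \<not> me, h @ [v], component (pre_digraph.del_vert G v) t, t), \<sigma>, me, h, G, t)
      \<in> Wellfounded.measure (\<lambda>(_, _, _, G, _). card (verts G))" by simp
qed simp

declare play.simps [simp del]

definition game :: "('a, 'b) strategy \<Rightarrow> bool \<Rightarrow> ('a, 'b) pre_digraph \<Rightarrow> bool pmf" where
  "game \<sigma> me G = bind_pmf (pmf_of_set (verts G)) (\<lambda>t. play \<sigma> me [] G t)"

definition \<P> :: "('a, 'b) pre_digraph \<Rightarrow> real" where
  "\<P> G = (SUP \<sigma>\<in>strategies. pmf (game \<sigma> True G) True)"

definition \<Q> :: "('a, 'b) pre_digraph \<Rightarrow> real" where
  "\<Q> G = (SUP \<sigma>\<in>strategies. pmf (game \<sigma> False G) True)"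

text \<open>
  The rest of this theory derives the recursion for \<open>\<P>\<close> and \<open>\<Q>\<close> from the game.
  Everything from here on is consequence, not part of the definition.
\<close>

abbreviation win_prob :: "('a, 'b) strategy \<Rightarrow> bool \<Rightarrow> 'a list \<Rightarrow> ('a, 'b) pre_digraph \<Rightarrow> real" where
  "win_prob \<sigma> me h G \<equiv> pmf (bind_pmf (pmf_of_set (verts G)) (\<lambda>t. play \<sigma> me h G t)) True"

lemma play_shift: "play \<sigma> me (h @ h') G t = play (\<lambda>h'. \<sigma> (h @ h')) me h' G t"
proof (induction "\<lambda>h'. \<sigma> (h @ h')" me h' G t rule: play.induct)
  case (1 me h' G t)
  show ?case
    by (subst (1 2) play.simps, rule bind_pmf_cong) (auto simp: 1)
qed

lemma win_prob_shift: "win_prob \<sigma> me h G = win_prob (\<lambda>h'. \<sigma> (h @ h')) me [] G"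
  using play_shift[of \<sigma> me h "[]"] by simp

lemma fin_digraph_component:
  assumes "fin_digraph G" "v \<in> verts G" "t \<in> verts G" "t \<noteq> v"
  defines "C \<equiv> component (pre_digraph.del_vert G v) t"
  shows "fin_digraph C" "card (verts C) < card (verts G)" "t \<in> verts C" "finite (verts C)"
proof -
  interpret fin_digraph G by fact
  interpret D: fin_digraph "del_vert v" by (rule fin_digraph_del_vert)
  have "verts C \<subseteq> verts G - {v}"
    unfolding C_def using verts_component_subset[of "del_vert v"] by (simp add: verts_del_vert)
  then show "card (verts C) < card (verts G)" using assms by (intro psubset_card_mono) auto
  show fin: "finite (verts C)" using \<open>verts C \<subseteq> _\<close> by (rule finite_subset) simp
  show "fin_digraph C" unfolding C_def component_def
    by unfold_locales (use fin in \<open>auto simp: C_def component_def\<close>)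
  show "t \<in> verts C" using D.in_scc_of_self[of t] assms by (simp add: C_def component_def verts_del_vert)
qed

lemma sum_components:
  assumes "fin_digraph D"
  shows "(\<Sum>t\<in>verts D. f (component D t) t) = (\<Sum>C\<in>pre_digraph.sccs D. \<Sum>t\<in>verts C. f C t)"
proof -
  interpret fin_digraph D by fact
  have S: "sccs = component D ` verts D"
    unfolding sccs_conv_sccs_verts sccs_verts_conv_scc_of by (simp add: component_def image_image)
  have eq: "{t\<in>verts D. component D t = C} = verts C" if C: "C \<in> sccs" for C
  proof -
    obtain u where u: "u \<in> verts D" "C = component D u" using C unfolding S by blast
    have "component D t = C \<longleftrightarrow> scc_of t = scc_of u" for t
      unfolding u component_def by (metis induce_subgraph_verts)
    moreover have "scc_of t = scc_of u \<longleftrightarrow> t \<in> scc_of u" if "t \<in> verts D" for t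
      using that in_scc_of_self scc_of_eq by blast
    ultimately show ?thesis using verts_component_subset[of D u] u
      by (auto simp: component_def)
  qed
  have "(\<Sum>t\<in>verts D. f (component D t) t) = (\<Sum>C\<in>component D ` verts D. \<Sum>t | t \<in> verts D \<and> component D t = C. f (component D t) t)"
    by (rule sum.image_gen) simp
  also have "\<dots> = (\<Sum>C\<in>sccs. \<Sum>t\<in>verts C. f C t)"
    unfolding S[symmetric] by (intro sum.cong refl) (auto simp flip: eq intro!: sum.cong)
  finally show ?thesis .
qed

lemma scc_component:
  assumes "fin_digraph G" "v \<in> verts G" "C \<in> pre_digraph.sccs (pre_digraph.del_vert G v)"
  shows "fin_digraph C" "card (verts C) < card (verts G)" "verts C \<noteq> {}" "finite (verts C)"
proof -
  interpret fin_digraph G by fact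
  interpret D: fin_digraph "del_vert v" by (rule fin_digraph_del_vert)
  have S: "D.sccs = component (del_vert v) ` verts (del_vert v)"
    unfolding D.sccs_conv_sccs_verts D.sccs_verts_conv_scc_of by (simp add: component_def image_image)
  then obtain t where "t \<in> verts G" "t \<noteq> v" and C: "C = component (del_vert v) t"
    using assms(3) unfolding S by (auto simp: verts_del_vert)
  then show "fin_digraph C" "card (verts C) < card (verts G)" "verts C \<noteq> {}" "finite (verts C)"
    using fin_digraph_component[OF assms(1,2), of t] by (auto simp: C)
qed

definition gain_after :: "(('a,'b) pre_digraph \<Rightarrow> real) \<Rightarrow> ('a,'b) pre_digraph \<Rightarrow> 'a \<Rightarrow> real" where
  "gain_after F G v = (\<Sum>C\<in>pre_digraph.sccs (pre_digraph.del_vert G v). real (card (verts C)) * F C)"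

lemma win_prob_gain_after:
  assumes "fin_digraph G" "v \<in> verts G"
  shows "(\<Sum>t\<in>verts G. pmf (if v = t then return_pmf me
     else play \<sigma> me' h (component (pre_digraph.del_vert G v) t) t) True) =
     of_bool me + gain_after (win_prob \<sigma> me' h) G v"
proof -
  interpret fin_digraph G by fact
  interpret D: fin_digraph "del_vert v" by (rule fin_digraph_del_vert)
  let ?f = "\<lambda>C t. pmf (play \<sigma> me' h C t) True"
  have "(\<Sum>t\<in>verts G. pmf (if v = t then return_pmf me
     else play \<sigma> me' h (component (pre_digraph.del_vert G v) t) t) True) =
     of_bool me + (\<Sum>t\<in>verts G - {v}. ?f (component (del_vert v) t) t)"
    proof (subst sum.remove[OF _ assms(2)], simp, rule arg_cong2[where f=plus], simp, rule sum.cong)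
    fix t assume "t \<in> verts G - {v}"
    then have "v \<noteq> t" by auto
    then show "pmf (if v = t then return_pmf me else play \<sigma> me' h (component (del_vert v) t) t) True =
        ?f (component (del_vert v) t) t" by simp
  qed simp
  also have "(\<Sum>t\<in>verts G - {v}. ?f (component (del_vert v) t) t) =
      (\<Sum>t\<in>verts (del_vert v). ?f (component (del_vert v) t) t)" by (simp add: verts_del_vert)
  also have "\<dots> = (\<Sum>C\<in>D.sccs. \<Sum>t\<in>verts C. ?f C t)"
    by (rule sum_components) unfold_locales
  also have "\<dots> = gain_after (win_prob \<sigma> me' h) G v"
    unfolding gain_after_def
  proof (intro sum.cong refl)
    fix C assume "C \<in> D.sccs"
    from scc_component[OF assms this]
    show "(\<Sum>t\<in>verts C. ?f C t) = card (verts C) * win_prob \<sigma> me' h C"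
      by (simp add: pmf_bind_pmf_of_set)
  qed
  finally show ?thesis .
qed

lemma win_prob_first:
  assumes "fin_digraph G" "verts G \<noteq> {}" "\<sigma> \<in> strategies"
  shows "win_prob \<sigma> True h G = (1 + gain_after (win_prob \<sigma> False (h @ [\<sigma> h G])) G (\<sigma> h G)) / card (verts G)"
proof -
  interpret fin_digraph G by fact
  have v: "\<sigma> h G \<in> verts G" using assms by (simp add: strategies_def)
  show ?thesis
    using win_prob_gain_after[OF assms(1) v, of True \<sigma> False] assms(2) v
    by (subst play.simps) (simp add: pmf_bind_pmf_of_set bind_return_pmf cong: if_cong)
qed

lemma win_prob_second:
  assumes "fin_digraph G" "verts G \<noteq> {}"
  shows "win_prob \<sigma> False h G = (\<Sum>v\<in>verts G. gain_after (win_prob \<sigma> True (h @ [v])) G v) / (card (verts G))\<^sup>2"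
proof -
  interpret fin_digraph G by fact
  let ?g = "\<lambda>v t. pmf (if v = t then return_pmf False
     else play \<sigma> True (h @ [v]) (component (pre_digraph.del_vert G v) t) t) True"
  have "win_prob \<sigma> False h G = (\<Sum>t\<in>verts G. (\<Sum>v\<in>verts G. ?g v t) / card (verts G)) / card (verts G)"
    by (subst play.simps) (auto simp: pmf_bind_pmf_of_set assms intro!: sum.cong)
  also have "\<dots> = (\<Sum>t\<in>verts G. \<Sum>v\<in>verts G. ?g v t) / (card (verts G))\<^sup>2"
    by (simp add: power2_eq_square flip: sum_divide_distrib)
  also have "(\<Sum>t\<in>verts G. \<Sum>v\<in>verts G. ?g v t) = (\<Sum>v\<in>verts G. \<Sum>t\<in>verts G. ?g v t)"
    by (rule sum.swap)
  also have "\<dots> = (\<Sum>v\<in>verts G. gain_after (win_prob \<sigma> True (h @ [v])) G v)"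
    using win_prob_gain_after[OF assms(1)] by (intro sum.cong) auto
  finally show ?thesis .
qed

lemma gain_after_mono:
  assumes "\<And>C. C \<in> pre_digraph.sccs (pre_digraph.del_vert G v) \<Longrightarrow> F C \<le> F' C"
  shows "gain_after F G v \<le> gain_after F' G v"
  unfolding gain_after_def using assms by (intro sum_mono mult_left_mono) auto

lemma gain_after_cong:
  assumes "\<And>C. C \<in> pre_digraph.sccs (pre_digraph.del_vert G v) \<Longrightarrow> F C = F' C"
  shows "gain_after F G v = gain_after F' G v"
  unfolding gain_after_def using assms by (intro sum.cong) auto

definition win_value :: "bool \<Rightarrow> ('a,'b) pre_digraph \<Rightarrow> real" where
  "win_value me G = (if me then \<P> G else \<Q> G)"

lemma shift_strategies: "\<sigma> \<in> strategies \<Longrightarrow> (\<lambda>h'. \<sigma> (h @ h')) \<in> strategies"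
  by (auto simp: strategies_def)

lemma strategies_nonempty: "strategies \<noteq> ({} :: ('a,'b) strategy set)"
proof -
  have "(\<lambda>h G. SOME v. v \<in> verts G) \<in> (strategies :: ('a,'b) strategy set)"
    by (auto simp: strategies_def some_in_eq)
  then show ?thesis by blast
qed

lemma win_value_upper: "\<sigma> \<in> strategies \<Longrightarrow> win_prob \<sigma> me h G \<le> win_value me G"
proof (subst win_prob_shift)
  assume s: "\<sigma> \<in> strategies"
  have bdd: "bdd_above ((\<lambda>\<sigma>. pmf (game \<sigma> me G) True) ` strategies)"
    by (rule bdd_aboveI[of _ 1]) (auto simp: pmf_le_1)
  show "win_prob (\<lambda>h'. \<sigma> (h @ h')) me [] G \<le> win_value me G"
    using cSUP_upper[OF shift_strategies[OF s, of h] bdd]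
    by (cases me) (auto simp: win_value_def \<P>_def \<Q>_def game_def)
qed

lemma win_value_least: "(\<And>\<sigma>. \<sigma> \<in> strategies \<Longrightarrow> win_prob \<sigma> me [] G \<le> c) \<Longrightarrow> win_value me G \<le> c"
  unfolding win_value_def \<P>_def \<Q>_def game_def
  by (auto intro!: cSUP_least strategies_nonempty)

definition best_guess :: "('a,'b) strategy" where
  "best_guess h G = (if finite (verts G) then ARG_MAX (gain_after \<Q> G) v. v \<in> verts G else (SOME v. v \<in> verts G))"

lemma best_guess:
  assumes "finite (verts G)" "v \<in> verts G"
  shows "best_guess h G \<in> verts G" "gain_after \<Q> G v \<le> gain_after \<Q> G (best_guess h G)"
proof -
  have "is_arg_max (gain_after \<Q> G) (\<lambda>v. v \<in> verts G) (best_guess h G)"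
  proof -
    obtain w where "is_arg_max (gain_after \<Q> G) (\<lambda>v. v \<in> verts G) w"
    proof -
      have "Max (gain_after \<Q> G ` verts G) \<in> gain_after \<Q> G ` verts G" using assms by (intro Max_in) auto
      then obtain w where "w \<in> verts G" "gain_after \<Q> G w = Max (gain_after \<Q> G ` verts G)" by auto
      then show thesis using assms by (intro that[of w]) (auto simp: is_arg_max_linorder)
    qed
    then show ?thesis using assms unfolding best_guess_def arg_max_def by (auto intro: someI)
  qed
  then show "best_guess h G \<in> verts G" "gain_after \<Q> G v \<le> gain_after \<Q> G (best_guess h G)"
    using assms by (auto simp: is_arg_max_linorder)
qed

lemma best_guess_strategy: "best_guess \<in> strategies"
  unfolding strategies_def
proof (safe)
  fix h :: "'a list" and G :: "('a,'b) pre_digraph" assume "best_guess h G \<notin> verts G"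
  then show "x \<in> {}" if "x \<in> verts G" for x
    using best_guess(1)[of G x h] that by (cases "finite (verts G)") (auto simp: best_guess_def intro: someI)
qed

lemma best_guess_optimal:
  assumes "fin_digraph G" "verts G \<noteq> {}"
  shows "win_prob best_guess me h G = win_value me G"
  using assms
proof (induction "card (verts G)" arbitrary: G me h rule: less_induct)
  case (less G me h)
  interpret fin_digraph G by fact
  have IH: "win_prob best_guess me h C = win_value me C"
    if "v \<in> verts G" "C \<in> pre_digraph.sccs (pre_digraph.del_vert G v)" for C v h me
    using less.hyps[of C] scc_component[OF less.prems(1) that] by blast
  have b: "best_guess h G \<in> verts G" using best_guess(1)[of G _ h] less.prems(2) by auto
  have "win_value me G \<le> win_prob best_guess me h G"
  proof (rule win_value_least)
    fix \<sigma> :: "('a,'b) strategy" assume s: "\<sigma> \<in> strategies"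
    show "win_prob \<sigma> me [] G \<le> win_prob best_guess me h G"
    proof (cases me)
      case True
      have v: "\<sigma> [] G \<in> verts G" using s less.prems by (auto simp: strategies_def)
      have "gain_after (win_prob \<sigma> False ([] @ [\<sigma> [] G])) G (\<sigma> [] G) \<le> gain_after (win_value False) G (\<sigma> [] G)"
        by (intro gain_after_mono win_value_upper s)
      also have "\<dots> \<le> gain_after (win_value False) G (best_guess h G)"
        using best_guess(2)[OF _ v] by (simp add: win_value_def[abs_def])
      also have "\<dots> = gain_after (win_prob best_guess False (h @ [best_guess h G])) G (best_guess h G)"
        by (intro gain_after_cong) (simp add: IH[OF b])
      finally have "win_prob \<sigma> True [] G \<le> win_prob best_guess True h G"
        unfolding win_prob_first[OF less.prems s] win_prob_first[OF less.prems best_guess_strategy]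
        by (intro divide_right_mono) auto
      then show ?thesis using True by simp
    next
      case False
      have "gain_after (win_prob \<sigma> True ([] @ [v])) G v \<le> gain_after (win_prob best_guess True (h @ [v])) G v" if "v \<in> verts G" for v
        by (intro gain_after_mono) (simp only: IH[OF that] win_value_upper[OF s])
      then show ?thesis
        using False by (simp only: win_prob_second[OF less.prems]) (intro divide_right_mono sum_mono, auto)
    qed
  qed
  then show ?case by (intro antisym win_value_upper best_guess_strategy)
qed

text \<open>
  The recursion that characterises \<open>\<P>\<close> and \<open>\<Q>\<close>; the components of \<open>G\<close> minus \<open>v\<close> are
  the strongly connected components of the symmetric digraph \<^term>\<open>pre_digraph.del_vert G v\<close>.
\<close>

theorem win_recursion:
  assumes "fin_digraph G" "verts G \<noteq> {}"
  shows "\<P> G = Max ((\<lambda>v. 1 / real (card (verts G)) + 1 / real (card (verts G)) *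
            (\<Sum>C\<in>pre_digraph.sccs (pre_digraph.del_vert G v). real (card (verts C)) * \<Q> C)) ` verts G)" (is ?P)
    and "\<Q> G = 1 / (real (card (verts G)))\<^sup>2 *
            (\<Sum>v\<in>verts G. \<Sum>C\<in>pre_digraph.sccs (pre_digraph.del_vert G v). real (card (verts C)) * \<P> C)" (is ?Q)
proof -
  interpret fin_digraph G by fact
  let ?n = "real (card (verts G))"
  have b: "best_guess h G \<in> verts G" for h using best_guess(1)[of G _ h] assms(2) by auto
  have opt: "gain_after (win_prob best_guess me h) G v = gain_after (win_value me) G v" if "v \<in> verts G" for v me h
    using scc_component[OF assms(1) that] by (intro gain_after_cong best_guess_optimal) auto
  have "\<P> G = (1 + gain_after \<Q> G (best_guess [] G)) / ?n"
    using win_prob_first[OF assms best_guess_strategy, of "[]"] best_guess_optimal[OF assms, of True "[]"] opt[OF b, of False]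
    by (simp add: win_value_def[abs_def])
  also have "\<dots> = Max ((\<lambda>v. (1 + gain_after \<Q> G v) / ?n) ` verts G)"
    using best_guess(2)[of G _ "[]"] b by (intro Max_eqI[symmetric]) (auto intro!: divide_right_mono)
  finally show ?P by (simp add: gain_after_def[symmetric] add_divide_distrib)
  have "\<Q> G = (\<Sum>v\<in>verts G. gain_after \<P> G v) / (card (verts G))\<^sup>2"
    using win_prob_second[OF assms, of best_guess "[]"] best_guess_optimal[OF assms, of False "[]"] opt[of _ True]
    by (simp add: win_value_def[abs_def])
  then show ?Q by (simp add: gain_after_def)
qed

end

theory Submission
  imports Defs
begin

text \<open>
  It is convenient to weight every winning probability by the number of vertices. Write
  \<open>B n\<close> for \<open>n\<close> times the value of \<open>\<Q>\<close> on the star with \<open>n\<close> vertices. Guessing a leaf of a star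
  leaves the next smaller star, guessing the center leaves isolated vertices. Hence guessing a
  leaf is optimal, \<open>n\<close> times the value of \<open>\<P>\<close> on the star is \<open>1 + B (n - 1)\<close>, and
  \<open>B (n + 2) = (n + 1) / (n + 2) * (2 + B n)\<close>.

  The whole comparison rests on \<open>B\<close> being superadditive (\<open>star_gain_superadditive\<close>): for the
  optimal player on the second move it is best not to have the remaining vertices split into
  several components. By induction on the number of vertices, a first guess in a tree of size
  \<open>n\<close> with remaining components of sizes \<open>a, b, \<dots>\<close> yields at most
  \<open>1 + B a + B b + \<dots> \<le> 1 + B (n - 1)\<close>, which is the claim for \<open>\<P>\<close>.

  For \<open>\<Q>\<close> the contributions of all guesses \<open>v\<close> and of all components left by \<open>v\<close> are added up.
  These pairs are the directed edges of the tree: the edge between \<open>v\<close> and \<open>w\<close> contributes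
  the component of \<open>w\<close> after \<open>v\<close> and the component of \<open>v\<close> after \<open>w\<close>, whose sizes \<open>s\<close> and \<open>s'\<close>
  have sum \<open>n\<close>. By induction and superadditivity the edge contributes at most
  \<open>(1 + B (s - 1)) + (1 + B (s' - 1)) \<le> 2 + B (n - 2)\<close>, and in a star every edge attains this bound.
  There are \<open>n - 1\<close> edges (\<open>sum_branches_le\<close>), which gives the claim for \<open>\<Q>\<close>.
\<close>

section \<open>The weighted value of the second player on a star\<close>

text \<open>
  The number \<open>B n\<close> of the introduction. The value at \<open>0\<close> is the one that makes
  \<open>1 + B (n - 1)\<close> correct for the star with a single vertex.
\<close>

fun star_gain :: "nat \<Rightarrow> real" where
  "star_gain 0 = 0"
| "star_gain (Suc 0) = 0"
| "star_gain (Suc (Suc n)) = (n + 1) / (n + 2) * (2 + star_gain n)"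

text \<open>
  Both bounds are linear of slope \<open>2 / 3\<close> and differ only by \<open>1 / 3\<close>. The recursion keeps the
  lower bound exactly and the upper bound with a little room, and the gap is so small that
  the sum of two upper bounds is a lower bound at the sum of the arguments.
\<close>

lemma star_gain_bounds:
  "2 * real n / 3 \<le> star_gain (Suc n) \<and> star_gain (Suc n) \<le> (2 * real n + 1) / 3"
proof (induction n rule: induct_nat_012)
  case (ge2 n)
  have "2 * real (Suc (Suc n)) / 3 = (n + 2) / (n + 3) * (2 + 2 * real n / 3)"
    by (simp add: field_simps)
  also have "\<dots> \<le> (n + 2) / (n + 3) * (2 + star_gain (Suc n))"
    using ge2.IH(1) by (intro mult_left_mono) auto
  finally have lower: "2 * real (Suc (Suc n)) / 3 \<le> star_gain (Suc (Suc (Suc n)))"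
    by (simp add: algebra_simps)
  have "star_gain (Suc (Suc (Suc n))) = (n + 2) / (n + 3) * (2 + star_gain (Suc n))"
    by (simp add: algebra_simps)
  also have "\<dots> \<le> (n + 2) / (n + 3) * (2 + (2 * real n + 1) / 3)"
    using ge2.IH(1) by (intro mult_left_mono) auto
  also have "\<dots> \<le> (2 * real (Suc (Suc n)) + 1) / 3"
    by (simp add: field_simps)
  finally show ?case using lower by blast
qed auto

lemma star_gain_nonneg: "0 \<le> star_gain n"
  by (induction n rule: star_gain.induct) auto

lemma star_gain_superadditive: "star_gain a + star_gain b \<le> star_gain (a + b)"
proof (cases a)
  case (Suc a')
  show ?thesis
  proof (cases b)
    case (Suc b')
    have "star_gain a + star_gain b \<le> 2 * real (Suc (a' + b')) / 3"
      using star_gain_bounds[of a'] star_gain_bounds[of b'] \<open>a = _\<close> \<open>b = _\<close>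
      by (simp add: field_simps)
    also have "\<dots> \<le> star_gain (a + b)"
      using star_gain_bounds[of "Suc (a' + b')"] \<open>a = _\<close> \<open>b = _\<close> by simp
    finally show ?thesis .
  qed simp
qed simp

lemma star_gain_mono: "a \<le> b \<Longrightarrow> star_gain a \<le> star_gain b"
  using star_gain_superadditive[of a "b - a"] star_gain_nonneg[of "b - a"] by simp

lemma sum_star_gain_le: "finite S \<Longrightarrow> (\<Sum>x\<in>S. star_gain (f x)) \<le> star_gain (\<Sum>x\<in>S. f x)"
proof (induction S rule: finite_induct)
  case (insert x S)
  then show ?case
    using star_gain_superadditive[of "f x" "\<Sum>x\<in>S. f x"] by simp
qed simp

section \<open>Branches of a tree\<close>

text \<open>
  In a symmetric digraph connectedness and strong connectedness agree; the latter is what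
  components come with, so that components of trees are again instances.
\<close>

locale finite_tree = graph +
  assumes strongly_connected: "strongly_connected G"
    and no_cycle: "cycle p \<Longrightarrow> length p < 3"
begin

text \<open>
  The vertex set of the component of \<open>t\<close> after the guess \<open>v\<close>. For an edge between \<open>v\<close> and \<open>w\<close>,
  \<^term>\<open>branch v w\<close> and \<^term>\<open>branch w v\<close> are the two sides of the edge.
\<close>

definition branch :: "'a \<Rightarrow> 'a \<Rightarrow> 'a set" where
  "branch v t = {x. t \<rightarrow>\<^sup>*\<^bsub>del_vert v\<^esub> x}"

lemma graph_del_vert: "graph (del_vert v)"
proof -
  have "induced_subgraph (del_vert v) G"
    by (rule induced_subgraphI[OF subgraph_del_vert]) (auto simp: del_vert_simps)
  then have "digraph (del_vert v)" "sym_digraph (del_vert v)"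
    by (rule digraphI_induced induced_graph_imp_graph)+
  then show ?thesis
    by (simp add: digraph.graphI sym_digraph.sym_arcs)
qed

lemma dominates_del_vert_iff: "u \<rightarrow>\<^bsub>del_vert v\<^esub> w \<longleftrightarrow> u \<rightarrow> w \<and> u \<noteq> v \<and> w \<noteq> v"
  by (auto simp: arcs_ends_conv del_vert_simps)

lemma branch_subset: "branch v t \<subseteq> verts G - {v}"
  by (auto simp: branch_def verts_del_vert elim!: reachable_in_vertsE)

lemma self_in_branch: "t \<in> verts G \<Longrightarrow> t \<noteq> v \<Longrightarrow> t \<in> branch v t"
proof -
  interpret D: graph "del_vert v" by (rule graph_del_vert)
  show "t \<in> verts G \<Longrightarrow> t \<noteq> v \<Longrightarrow> t \<in> branch v t"
    by (simp add: branch_def verts_del_vert)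
qed

lemma branch_eq: "x \<in> branch v t \<Longrightarrow> branch v x = branch v t"
proof -
  interpret D: graph "del_vert v" by (rule graph_del_vert)
  show "x \<in> branch v t \<Longrightarrow> branch v x = branch v t"
    unfolding branch_def by (auto intro: D.reachable_trans D.symmetric_reachable')
qed

lemma branch_step: "x \<in> branch v t \<Longrightarrow> x \<rightarrow> y \<Longrightarrow> y \<noteq> v \<Longrightarrow> y \<in> branch v t"
proof -
  interpret D: graph "del_vert v" by (rule graph_del_vert)
  assume "x \<in> branch v t" "x \<rightarrow> y" "y \<noteq> v"
  moreover from this have "x \<noteq> v" using branch_subset by blast
  ultimately show "y \<in> branch v t"
    unfolding branch_def by (auto intro: D.reachable_adj_trans simp: dominates_del_vert_iff)
qed

lemma scc_of_del_vert: "pre_digraph.scc_of (del_vert v) t = branch v t"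
proof -
  interpret D: graph "del_vert v" by (rule graph_del_vert)
  show ?thesis
    unfolding D.scc_of_def branch_def by (auto intro: D.symmetric_reachable')
qed

lemma sccs_verts_del_vert: "pre_digraph.sccs_verts (del_vert v) = branch v ` (verts G - {v})"
proof -
  interpret D: graph "del_vert v" by (rule graph_del_vert)
  show ?thesis
    unfolding D.sccs_verts_conv_scc_of scc_of_del_vert by (simp add: verts_del_vert)
qed

text \<open>
  This is the only consequence of acyclicity that the counting needs: a path between two distinct
  neighbours of \<open>v\<close> that avoids \<open>v\<close> closes up through \<open>v\<close> to a cycle of length at least 3.
\<close>

lemma adj_unique_in_branch:
  assumes "v \<rightarrow> x" "v \<rightarrow> y" "y \<in> branch v x"
  shows "x = y"
proof (rule ccontr)
  assume "x \<noteq> y"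
  interpret D: graph "del_vert v" by (rule graph_del_vert)
  obtain p where p: "D.apath x p y"
    using assms(3) by (auto simp: branch_def D.reachable_apath)
  have "p \<noteq> []" using p \<open>x \<noteq> y\<close> by (auto simp: D.apath_Nil_iff)
  have v: "v \<notin> set (D.awalk_verts x p)"
  proof -
    have "D.awalk x p y" using p by (rule D.awalkI_apath)
    then have "set (D.awalk_verts x p) \<subseteq> verts (del_vert v)" by (rule D.awalkE')
    then show ?thesis by (auto simp: verts_del_vert)
  qed
  have path: "apath x p y"
    using subgraph_apath_imp_apath[OF p subgraph_del_vert] .
  have av: "D.awalk_verts x p = awalk_verts x p"
    using subgraph_del_vert[of v] by (metis compatible_awalk_verts subgraphE)
  obtain e where e: "e \<in> arcs G" "tail G e = v" "head G e = x" using assms(1) by blast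
  obtain e' where e': "e' \<in> arcs G" "tail G e' = y" "head G e' = v"
    using graph_symmetric[OF assms(2)] by blast
  have "awalk v (e # p @ [e']) v"
    using path e e' by (auto simp: apath_def awalk_simps)
  moreover have "distinct (tl (awalk_verts v (e # p @ [e'])))"
  proof -
    have "awlast x p = y" using path by (auto simp: apath_def)
    then have "awalk_verts x (p @ [e']) = awalk_verts x p @ [v]"
      using e' \<open>p \<noteq> []\<close> by (simp add: awalk_verts_conv)
    then show ?thesis using path v av e by (auto simp: apath_def)
  qed
  ultimately have "cycle (e # p @ [e'])" unfolding cycle_def by auto
  from no_cycle[OF this] \<open>p \<noteq> []\<close> show False by (cases p) auto
qed

lemma reachable_in_tree: "u \<in> verts G \<Longrightarrow> v \<in> verts G \<Longrightarrow> u \<rightarrow>\<^sup>* v"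
  using strongly_connected by (simp add: strongly_connected_def)

lemma adj_in_verts_neq: "v \<rightarrow> w \<Longrightarrow> v \<in> verts G \<and> w \<in> verts G \<and> v \<noteq> w"
  using adj_in_verts adj_not_same by blast

text \<open>
  A walk from \<open>v\<close> that avoids \<open>w\<close> can enter the side of \<open>w\<close> only by a step from \<open>v\<close> to a vertex
  other than \<open>w\<close>; that vertex and \<open>w\<close> would be two neighbours of \<open>v\<close> in one component.
\<close>

lemma branches_disjoint:
  assumes "v \<rightarrow> w"
  shows "branch v w \<inter> branch w v = {}"
proof -
  interpret D: graph "del_vert w" by (rule graph_del_vert)
  have "x \<notin> branch v w" if "v \<rightarrow>\<^sup>*\<^bsub>del_vert w\<^esub> x" for x
    using that
  proof (induction rule: D.reachable_induct)
    case base
    then show ?case using branch_subset by blast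
  next
    case (step x y)
    then have adj: "x \<rightarrow> y" "x \<noteq> w" "y \<noteq> w" by (auto simp: dominates_del_vert_iff)
    show ?case
    proof
      assume y: "y \<in> branch v w"
      show False
      proof (cases "x = v")
        case True
        then show False using adj_unique_in_branch[OF assms _ y] adj by blast
      next
        case False
        then show False using branch_step[OF y graph_symmetric[OF adj(1)]] step.IH by blast
      qed
    qed
  qed
  then show ?thesis by (auto simp: branch_def)
qed

lemma branches_cover:
  assumes "v \<rightarrow> w" "x \<in> verts G"
  shows "x \<in> branch v w \<or> x \<in> branch w v"
proof -
  have vw: "v \<in> verts G" "w \<in> verts G" "v \<noteq> w" using adj_in_verts_neq[OF assms(1)] by auto
  then have "v \<rightarrow>\<^sup>* x" using reachable_in_tree assms(2) by blast
  then show ?thesis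
  proof (induction rule: reachable_induct)
    case base
    then show ?case using self_in_branch vw by blast
  next
    case (step x y)
    consider "y = v" | "y = w" | "y \<noteq> v" "y \<noteq> w" by blast
    then show ?case
    proof cases
      case 3
      then show ?thesis using step.IH branch_step[OF _ step.hyps(2)] by blast
    qed (use self_in_branch vw in auto)
  qed
qed

text \<open>
  On a walk from \<open>t\<close> to \<open>v\<close>, the vertex just before the first visit of \<open>v\<close> lies in the component
  of \<open>t\<close>.
\<close>

lemma adj_in_branch:
  assumes "v \<in> verts G" "t \<in> verts G" "t \<noteq> v"
  obtains w where "w \<in> branch v t" "v \<rightarrow> w"
proof -
  have "t \<rightarrow>\<^sup>* v" using reachable_in_tree assms by blast
  then have "t \<noteq> v \<longrightarrow> (\<exists>w\<in>branch v t. v \<rightarrow> w)"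
  proof (induction rule: converse_reachable_induct)
    case (step x y)
    show ?case
    proof
      assume "x \<noteq> v"
      then have x: "x \<in> branch v x" using self_in_branch adj_in_verts step.hyps(1) by blast
      show "\<exists>w\<in>branch v x. v \<rightarrow> w"
      proof (cases "y = v")
        case True
        then show ?thesis using x graph_symmetric[OF step.hyps(1)] by blast
      next
        case False
        then have "branch v y = branch v x" using branch_eq branch_step[OF x step.hyps(1)] by blast
        then show ?thesis using step.IH False by simp
      qed
    qed
  qed simp
  then show thesis using that assms by blast
qed

text \<open>
  The pairs of a guess and a component that it leaves are grouped by edges. To have each edge once,
  the tree is rooted at some \<open>r\<close>, and every other vertex \<open>w\<close> stands for the edge to its parent.
  A component \<open>K\<close> left by \<open>v\<close> that contains \<open>r\<close> is the upper side of the edge above \<open>v\<close>;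
  a component without \<open>r\<close> is the lower side of the edge above some child \<open>w\<close> of \<open>v\<close>.
\<close>

lemma sum_branches_le:
  fixes f :: "nat \<Rightarrow> real"
  assumes nonneg: "\<And>s. 0 \<le> f s"
    and pair: "\<And>s s'. 0 < s \<Longrightarrow> 0 < s' \<Longrightarrow> s + s' \<le> card (verts G) \<Longrightarrow> f s + f s' \<le> c"
  shows "(\<Sum>v\<in>verts G. \<Sum>K\<in>branch v ` (verts G - {v}). f (card K)) \<le> (real (card (verts G)) - 1) * c"
proof -
  let ?V = "verts G"
  obtain r where r: "r \<in> ?V"
    using strongly_connected by (auto simp: strongly_connected_def)
  define parent where "parent w = (SOME u. u \<in> branch w r \<and> w \<rightarrow> u)" for w
  have parent: "parent w \<in> branch w r" "w \<rightarrow> parent w" if w: "w \<in> ?V - {r}" for w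
  proof -
    have "\<exists>u. u \<in> branch w r \<and> w \<rightarrow> u"
      using adj_in_branch[of w r] r w by blast
    then have "parent w \<in> branch w r \<and> w \<rightarrow> parent w"
      unfolding parent_def by (rule someI_ex)
    then show "parent w \<in> branch w r" "w \<rightarrow> parent w" by auto
  qed
  define X where "X = (SIGMA v:?V. branch v ` (?V - {v}))"
  define up where "up w = (w, branch w r)" for w
  define down where "down w = (parent w, branch (parent w) w)" for w
  let ?f = "\<lambda>p. f (card (snd p))"
  have fin: "finite X" by (simp add: X_def)
  have up: "{p \<in> X. r \<in> snd p} \<subseteq> up ` (?V - {r})"
  proof
    fix p assume "p \<in> {p \<in> X. r \<in> snd p}"
    then obtain v t where vt: "p = (v, branch v t)" "v \<in> ?V" "t \<in> ?V - {v}" "r \<in> branch v t"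
      unfolding X_def by fastforce
    then have "branch v r = branch v t" "v \<noteq> r" using branch_eq branch_subset by blast+
    then show "p \<in> up ` (?V - {r})" using vt by (auto simp: up_def)
  qed
  have down: "{p \<in> X. r \<notin> snd p} \<subseteq> down ` (?V - {r})"
  proof
    fix p assume "p \<in> {p \<in> X. r \<notin> snd p}"
    then obtain v t where vt: "p = (v, branch v t)" "v \<in> ?V" "t \<in> ?V" "t \<noteq> v" "r \<notin> branch v t"
      unfolding X_def by fastforce
    obtain w where w: "w \<in> branch v t" "v \<rightarrow> w" using adj_in_branch[OF vt(2-4)] .
    have eq: "branch v w = branch v t" using branch_eq[OF w(1)] .
    have wV: "w \<in> ?V - {r}" using w vt(5) branch_subset by blast
    \<comment> \<open>The root is on the side of \<open>v\<close>, so the edge from \<open>w\<close> towards the root ends in \<open>v\<close>.\<close>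
    have "r \<in> branch w v" using branches_cover[OF w(2) r] vt(5) eq by blast
    then have "parent w \<in> branch w v" using parent(1)[OF wV] branch_eq by blast
    then have "parent w = v"
      using adj_unique_in_branch[OF graph_symmetric[OF w(2)] parent(2)[OF wV]] by simp
    then show "p \<in> down ` (?V - {r})"
      using vt(1) eq wV by (auto simp: down_def intro!: image_eqI[of _ _ w])
  qed
  have le: "sum ?f S \<le> (\<Sum>w\<in>?V - {r}. ?f (g w))" if "S \<subseteq> g ` (?V - {r})" for S g
  proof -
    have "sum ?f S \<le> sum ?f (g ` (?V - {r}))" using that nonneg by (intro sum_mono2) auto
    also have "\<dots> \<le> sum (?f \<circ> g) (?V - {r})" using nonneg by (intro sum_image_le) auto
    finally show ?thesis by simp
  qed
  have "(\<Sum>v\<in>?V. \<Sum>K\<in>branch v ` (?V - {v}). f (card K)) = sum ?f X"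
    unfolding X_def by (subst sum.Sigma) (auto simp: case_prod_beta)
  also have "\<dots> = sum ?f {p \<in> X. r \<in> snd p} + sum ?f {p \<in> X. r \<notin> snd p}"
    using fin by (subst sum.union_disjoint[symmetric]) (auto intro!: sum.cong)
  also have "\<dots> \<le> (\<Sum>w\<in>?V - {r}. ?f (up w)) + (\<Sum>w\<in>?V - {r}. ?f (down w))"
    using le[OF up] le[OF down] by (rule add_mono)
  also have "\<dots> = (\<Sum>w\<in>?V - {r}. f (card (branch w r)) + f (card (branch (parent w) w)))"
    by (simp add: sum.distrib up_def down_def)
  also have "\<dots> \<le> (\<Sum>w\<in>?V - {r}. c)"
  proof (rule sum_mono)
    fix w assume w: "w \<in> ?V - {r}"
    let ?A = "branch w r" and ?B = "branch (parent w) w"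
    have fin: "finite ?A" "finite ?B"
      by (rule finite_subset[OF branch_subset]; simp)+
    have "?A = branch w (parent w)" using branch_eq[OF parent(1)[OF w]] by simp
    then have "?A \<inter> ?B = {}" using branches_disjoint[OF parent(2)[OF w]] by simp
    then have "card ?A + card ?B = card (?A \<union> ?B)" using fin by (simp add: card_Un_disjoint)
    also have "\<dots> \<le> card ?V" using branch_subset by (intro card_mono) auto
    finally have "card ?A + card ?B \<le> card ?V" .
    moreover have "r \<in> ?A" "w \<in> ?B"
      using self_in_branch r w adj_in_verts_neq[OF parent(2)[OF w]] by auto
    then have "0 < card ?A" "0 < card ?B" using fin by (auto simp: card_gt_0_iff)
    ultimately show "f (card ?A) + f (card ?B) \<le> c" using pair by blast
  qed
  also have "\<dots> = (real (card ?V) - 1) * c"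
  proof -
    have "0 < card ?V" using r by (auto simp: card_gt_0_iff)
    then show ?thesis using r by (simp add: of_nat_diff Suc_leI)
  qed
  finally show ?thesis .
qed

lemma finite_tree_component:
  assumes "C \<in> pre_digraph.sccs (del_vert v)"
  shows "finite_tree C"
proof -
  interpret D: graph "del_vert v" by (rule graph_del_vert)
  have ind: "induced_subgraph C (del_vert v)" and conn: "strongly_connected C"
    using assms by (auto simp: D.sccs_def)
  have "digraph C" "sym_digraph C"
    using ind by (rule D.digraphI_induced D.induced_graph_imp_graph)+
  then have "graph C" by (simp add: digraph.graphI sym_digraph.sym_arcs)
  moreover have "subgraph C G"
    using subgraph_trans[OF induced_imp_subgraph[OF ind] subgraph_del_vert] .
  then have "length p < 3" if "pre_digraph.cycle C p" for p
    using no_cycle subgraph_cycle that by blast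
  ultimately show ?thesis using conn
    by (simp add: finite_tree_def finite_tree_axioms_def)
qed

end

lemma undirected_tree_imp_finite_tree: "undirected_tree T \<Longrightarrow> finite_tree T"
proof -
  assume T: "undirected_tree T"
  then interpret graph T by (simp add: undirected_tree_def)
  show "finite_tree T"
    using T symmetric_connected_imp_strongly_connected[OF sym_arcs]
    by unfold_locales (auto simp: undirected_tree_def not_le[symmetric])
qed

section \<open>The recursion with weights\<close>

lemma card_mult_\<P>:
  assumes "fin_digraph G" "verts G \<noteq> {}"
  shows "card (verts G) * \<P> G = Max ((\<lambda>v. 1 + gain_after \<Q> G v) ` verts G)"
proof -
  interpret fin_digraph G by fact
  let ?n = "real (card (verts G))"
  have n: "0 < ?n" using assms(2) by (simp add: card_gt_0_iff)
  have "\<P> G = Max ((\<lambda>v. (1 + gain_after \<Q> G v) / ?n) ` verts G)"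
    using win_recursion(1)[OF assms] by (simp add: gain_after_def[symmetric] add_divide_distrib)
  also have "?n * \<dots> = Max ((*) ?n ` (\<lambda>v. (1 + gain_after \<Q> G v) / ?n) ` verts G)"
    using assms(2) by (intro mono_Max_commute monoI mult_left_mono) auto
  finally show ?thesis using n by (simp add: image_image)
qed

lemma card_mult_\<Q>:
  assumes "fin_digraph G" "verts G \<noteq> {}"
  shows "card (verts G) * \<Q> G = (\<Sum>v\<in>verts G. gain_after \<P> G v) / card (verts G)"
  using win_recursion(2)[OF assms] by (simp add: gain_after_def[symmetric] power2_eq_square)


lemma gain_after_le:
  fixes F :: "('a, 'b) pre_digraph \<Rightarrow> real" and f :: "nat \<Rightarrow> real"
  assumes "fin_digraph G"
    and "\<And>C. C \<in> pre_digraph.sccs (pre_digraph.del_vert G v) \<Longrightarrow> card (verts C) * F C \<le> f (card (verts C))"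
  shows "gain_after F G v \<le> (\<Sum>K\<in>pre_digraph.sccs_verts (pre_digraph.del_vert G v). f (card K))"
proof -
  interpret fin_digraph G by fact
  interpret D: fin_digraph "del_vert v" by (rule fin_digraph_del_vert)
  have "inj_on (induce_subgraph (del_vert v)) D.sccs_verts"
    by (rule inj_onI) (metis induce_subgraph_verts)
  then have "(\<Sum>K\<in>D.sccs_verts. f (card K)) = (\<Sum>C\<in>D.sccs. f (card (verts C)))"
    unfolding D.sccs_conv_sccs_verts by (simp add: sum.reindex)
  then show ?thesis
    using assms(2) unfolding gain_after_def by (simp add: sum_mono)
qed

text \<open>
  Summing over the possible targets instead of the components absorbs the weights, which suits
  stars, where all components left by a guess have the same size.
\<close>

lemma gain_after_conv_sum:
  assumes "fin_digraph G"
  shows "gain_after F G v = (\<Sum>t\<in>verts G - {v}. F (component (pre_digraph.del_vert G v) t))"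
proof -
  interpret fin_digraph G by fact
  have "fin_digraph (del_vert v)" by (rule fin_digraph_del_vert)
  from sum_components[OF this, of "\<lambda>C t. F C"] show ?thesis
    by (simp add: gain_after_def verts_del_vert)
qed

section \<open>Trees are at most as good as stars\<close>

lemma (in finite_tree) sum_card_sccs_del_vert:
  assumes "v \<in> verts G"
  shows "(\<Sum>K\<in>pre_digraph.sccs_verts (del_vert v). card K) = card (verts G) - 1"
proof -
  interpret D: graph "del_vert v" by (rule graph_del_vert)
  have fin: "finite K" if "K \<in> D.sccs_verts" for K
    using D.sccs_verts_subsets[OF that] D.finite_verts finite_subset by blast
  have "(\<Sum>K\<in>D.sccs_verts. card K) = card (\<Union>D.sccs_verts)"
    using fin D.sccs_verts_disjoint
    by (intro card_Union_disjoint[symmetric]) (auto simp: pairwise_def disjnt_def)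
  also have "\<Union>D.sccs_verts = verts G - {v}"
    unfolding sccs_verts_del_vert using branch_subset self_in_branch by fastforce
  finally show ?thesis using assms by simp
qed

text \<open>
  The induction is simultaneous: the bound for \<open>\<P>\<close> uses that for \<open>\<Q>\<close> on the components and
  conversely. Superadditivity enters twice, to merge all components left by one guess, and to
  merge the two sides of an edge without its two end points.
\<close>

lemma finite_tree_upper_bounds:
  assumes "finite_tree G"
  shows "card (verts G) * \<P> G \<le> 1 + star_gain (card (verts G) - 1)
    \<and> card (verts G) * \<Q> G \<le> star_gain (card (verts G))"
  using assms
proof (induction "card (verts G)" arbitrary: G rule: less_induct)
  case (less G)
  interpret finite_tree G by fact
  let ?n = "card (verts G)"
  have ne: "verts G \<noteq> {}" using strongly_connected by (auto simp: strongly_connected_def)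
  then have pos: "0 < ?n" by (simp add: card_gt_0_iff)
  have IH: "card (verts C) * \<P> C \<le> 1 + star_gain (card (verts C) - 1)"
      "card (verts C) * \<Q> C \<le> star_gain (card (verts C))"
    if "v \<in> verts G" "C \<in> pre_digraph.sccs (del_vert v)" for v C
    using less.hyps[OF scc_component(2)[OF fin_digraph that] finite_tree_component[OF that(2)]] by auto
  have "1 + gain_after \<Q> G v \<le> 1 + star_gain (?n - 1)" if v: "v \<in> verts G" for v
  proof -
    interpret D: graph "del_vert v" by (rule graph_del_vert)
    have "gain_after \<Q> G v \<le> (\<Sum>K\<in>D.sccs_verts. star_gain (card K))"
      using IH(2)[OF v] by (rule gain_after_le[OF fin_digraph])
    also have "\<dots> \<le> star_gain (\<Sum>K\<in>D.sccs_verts. card K)"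
      by (rule sum_star_gain_le[OF D.finite_sccs_verts])
    finally show ?thesis using sum_card_sccs_del_vert[OF v] by simp
  qed
  then have P: "?n * \<P> G \<le> 1 + star_gain (?n - 1)"
    unfolding card_mult_\<P>[OF fin_digraph ne] using ne by simp
  have "?n * \<Q> G \<le> star_gain ?n"
  proof (cases "?n = 1")
    case True
    then obtain v where V: "verts G = {v}" by (auto simp: card_1_singleton_iff)
    have "?n * \<Q> G = 0"
      unfolding card_mult_\<Q>[OF fin_digraph ne] by (simp add: V gain_after_conv_sum[OF fin_digraph])
    then show ?thesis using True by simp
  next
    case False
    then obtain m where m: "?n = Suc (Suc m)" using pos by (cases ?n rule: nat.exhaust; cases "?n - 1") auto
    have pair: "(1 + star_gain (s - 1)) + (1 + star_gain (s' - 1)) \<le> 2 + star_gain m"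
      if "0 < s" "0 < s'" "s + s' \<le> ?n" for s s'
    proof -
      have "star_gain (s - 1) + star_gain (s' - 1) \<le> star_gain (s - 1 + (s' - 1))"
        by (rule star_gain_superadditive)
      also have "\<dots> \<le> star_gain m" using that m by (intro star_gain_mono) linarith
      finally show ?thesis by simp
    qed
    have "(\<Sum>v\<in>verts G. gain_after \<P> G v)
        \<le> (\<Sum>v\<in>verts G. \<Sum>K\<in>branch v ` (verts G - {v}). 1 + star_gain (card K - 1))"
      unfolding sccs_verts_del_vert[symmetric]
      using IH(1) by (intro sum_mono gain_after_le[OF fin_digraph]) auto
    also have "\<dots> \<le> (real ?n - 1) * (2 + star_gain m)"
      using pair by (intro sum_branches_le) (auto intro: add_nonneg_nonneg star_gain_nonneg)
    finally have "?n * \<Q> G \<le> (real ?n - 1) * (2 + star_gain m) / ?n"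
      unfolding card_mult_\<Q>[OF fin_digraph ne] by (rule divide_right_mono) simp
    also have "\<dots> = star_gain ?n" unfolding m by (simp add: algebra_simps)
    finally show ?thesis .
  qed
  with P show ?case ..
qed

section \<open>The values of stars\<close>

text \<open>
  Guessing a leaf of \<^term>\<open>star n\<close> leaves a star on other vertices than an initial segment of the
  natural numbers, so the induction runs over stars with an arbitrary vertex set and center.
\<close>

definition star_shaped :: "('a, 'b) pre_digraph \<Rightarrow> 'a \<Rightarrow> bool" where
  "star_shaped G c \<longleftrightarrow> fin_digraph G \<and> c \<in> verts G \<and>
     (\<forall>u\<in>verts G. \<forall>w\<in>verts G. u \<rightarrow>\<^bsub>G\<^esub> w \<longleftrightarrow> (u = c) \<noteq> (w = c))"

lemma dominates_component_iff:
  "u \<rightarrow>\<^bsub>component (pre_digraph.del_vert G v) t\<^esub> w \<longleftrightarrow> u \<rightarrow>\<^bsub>G\<^esub> w \<and> u \<noteq> v \<and> w \<noteq> v \<and>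
     u \<in> verts (component (pre_digraph.del_vert G v) t) \<and> w \<in> verts (component (pre_digraph.del_vert G v) t)"
  by (auto simp: component_def arcs_ends_conv pre_digraph.del_vert_simps)

text \<open>
  An isolated vertex, which is what remains after guessing the center, is also a star, with itself
  as center. So the two kinds of guesses can be treated by one induction hypothesis.
\<close>

lemma star_shaped_component:
  assumes G: "star_shaped G c" and v: "v \<in> verts G" and t: "t \<in> verts G - {v}"
  defines "C \<equiv> component (pre_digraph.del_vert G v) t"
  shows "star_shaped C (if v = c then t else c)"
    and "card (verts C) = (if v = c then 1 else card (verts G) - 1)"
proof -
  interpret fin_digraph G using G by (simp add: star_shaped_def)
  interpret D: fin_digraph "del_vert v" by (rule fin_digraph_del_vert)
  have adj: "u \<rightarrow>\<^bsub>G\<^esub> w \<longleftrightarrow> (u = c) \<noteq> (w = c)" if "u \<in> verts G" "w \<in> verts G" for u w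
    using G that by (simp add: star_shaped_def)
  have D: "u \<rightarrow>\<^bsub>del_vert v\<^esub> w \<longleftrightarrow> u \<rightarrow>\<^bsub>G\<^esub> w \<and> u \<noteq> v \<and> w \<noteq> v" for u w
    by (auto simp: arcs_ends_conv del_vert_simps)
  have c: "c \<in> verts G" using G by (simp add: star_shaped_def)
  have C: "verts C = (if v = c then {t} else verts G - {v})"
  proof (cases "v = c")
    case True
    have isolated: "\<not> t \<rightarrow>\<^bsub>del_vert v\<^esub> w" for w
      using D adj adj_in_verts True by blast
    have "x = t" if "t \<rightarrow>\<^sup>*\<^bsub>del_vert v\<^esub> x" for x
      using that by (cases rule: D.converse_reachable_cases) (use isolated in auto)
    then have "D.scc_of t = {t}" using t by (auto simp: D.scc_of_def verts_del_vert)
    then show ?thesis using True by (simp add: C_def component_def)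
  next
    case False
    have "u \<rightarrow>\<^sup>*\<^bsub>del_vert v\<^esub> c" "c \<rightarrow>\<^sup>*\<^bsub>del_vert v\<^esub> u" if u: "u \<in> verts G - {v}" for u
      using u c False adj by (cases "u = c"; auto simp: D verts_del_vert)+
    then have "D.scc_of t = verts G - {v}"
      using t D.reachable_in_verts unfolding D.scc_of_def
      by (auto simp: verts_del_vert intro: D.reachable_trans)
    then show ?thesis using False by (simp add: C_def component_def)
  qed
  then show "card (verts C) = (if v = c then 1 else card (verts G) - 1)"
    using v by simp
  have "fin_digraph C"
    using fin_digraph_component(1)[OF fin_digraph v] t by (simp add: C_def)
  then show "star_shaped C (if v = c then t else c)"
    using C c t adj dominates_component_iff[where G = G and v = v and t = t] unfolding C_def[symmetric] star_shaped_def
    by auto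
qed

text \<open>
  For \<open>\<P>\<close> the bound comes from guessing any leaf. For \<open>\<Q>\<close>, each of the \<open>n - 1\<close> leaves contributes
  \<open>1 + B (n - 2)\<close>, and the center contributes \<open>n - 1\<close>, as the optimal player then
  knows the target.
\<close>

lemma star_shaped_lower_bounds:
  assumes "star_shaped G c"
  shows "1 + star_gain (card (verts G) - 1) \<le> card (verts G) * \<P> G
    \<and> star_gain (card (verts G)) \<le> card (verts G) * \<Q> G"
  using assms
proof (induction "card (verts G)" arbitrary: G c rule: less_induct)
  case (less G c)
  interpret fin_digraph G using less.prems by (simp add: star_shaped_def)
  let ?V = "verts G" and ?n = "card (verts G)"
  let ?C = "\<lambda>v. component (del_vert v)"
  have c: "c \<in> ?V" using less.prems by (simp add: star_shaped_def)
  then have ne: "?V \<noteq> {}" by auto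
  have gain_P: "1 + gain_after \<Q> G v \<le> ?n * \<P> G" if "v \<in> ?V" for v
    unfolding card_mult_\<P>[OF fin_digraph ne] using that by simp
  show ?case
  proof (cases "?n = 1")
    case True
    then have V: "?V = {c}" using c by (auto simp: card_1_singleton_iff)
    have gain: "gain_after F G c = 0" for F :: "('a, 'b) pre_digraph \<Rightarrow> real"
      by (simp add: gain_after_conv_sum[OF fin_digraph] V)
    have "?n * \<Q> G = 0" unfolding card_mult_\<Q>[OF fin_digraph ne] by (simp add: V gain)
    then show ?thesis using gain_P[OF c] True by (simp add: gain)
  next
    case False
    have "0 < ?n" using ne by (simp add: card_gt_0_iff)
    with False obtain m where m: "?n = Suc (Suc m)" by (cases ?n rule: nat.exhaust; cases "?n - 1") auto
    have IH: "1 + star_gain (card (verts (?C v t)) - 1) \<le> card (verts (?C v t)) * \<P> (?C v t)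
        \<and> star_gain (card (verts (?C v t))) \<le> card (verts (?C v t)) * \<Q> (?C v t)"
      if "v \<in> ?V" "t \<in> ?V - {v}" for v t
      using less.hyps[OF _ star_shaped_component(1)[OF less.prems that]]
        fin_digraph_component(2)[OF fin_digraph that(1)] that(2) by blast
    have leaf_P: "1 + star_gain m \<le> Suc m * \<P> (?C v t)"
      and leaf_Q: "star_gain (Suc m) \<le> Suc m * \<Q> (?C v t)"
      if "v \<in> ?V - {c}" "t \<in> ?V - {v}" for v t
      using IH[of v t] star_shaped_component(2)[OF less.prems, of v t] that m by auto
    have center_P: "1 \<le> \<P> (?C c t)" if "t \<in> ?V - {c}" for t
      using IH[OF c that] star_shaped_component(2)[OF less.prems c that] by simp
    have sum_leaf: "Suc m * a \<le> gain_after F G v"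
      if "v \<in> ?V" and "\<And>t. t \<in> ?V - {v} \<Longrightarrow> a \<le> F (?C v t)" for v F and a :: real
    proof -
      have "(\<Sum>t\<in>?V - {v}. a) \<le> gain_after F G v"
        unfolding gain_after_conv_sum[OF fin_digraph] using that(2) by (rule sum_mono)
      then show ?thesis using that(1) m by simp
    qed
    have scale: "x / Suc m \<le> y \<longleftrightarrow> x \<le> Suc m * y" for x y :: real
      by (simp add: field_simps)
    have "?V - {c} \<noteq> {}"
    proof
      assume "?V - {c} = {}"
      then have "?V = {c}" using c by blast
      then show False using m by simp
    qed
    then obtain v where v: "v \<in> ?V - {c}" by blast
    have "Suc m * (star_gain (Suc m) / Suc m) \<le> gain_after \<Q> G v"
      using v leaf_Q[OF v] by (intro sum_leaf) (auto simp: scale simp del: of_nat_Suc star_gain.simps)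
    then have P: "1 + star_gain (?n - 1) \<le> ?n * \<P> G"
      using gain_P[of v] v m by (simp del: of_nat_Suc star_gain.simps)
    have leaf: "1 + star_gain m \<le> gain_after \<P> G v" if "v \<in> ?V - {c}" for v
    proof -
      have "Suc m * ((1 + star_gain m) / Suc m) \<le> gain_after \<P> G v"
        using that leaf_P[OF that] by (intro sum_leaf) (auto simp: scale simp del: of_nat_Suc)
      then show ?thesis by (simp del: of_nat_Suc)
    qed
    have center: "real (Suc m) * 1 \<le> gain_after \<P> G c"
      using c center_P by (rule sum_leaf)
    have "Suc m * (2 + star_gain m) = Suc m * 1 + (\<Sum>v\<in>?V - {c}. 1 + star_gain m)"
      using c m by (simp add: algebra_simps)
    also have "\<dots> \<le> gain_after \<P> G c + (\<Sum>v\<in>?V - {c}. gain_after \<P> G v)"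
      using center leaf by (intro add_mono sum_mono) auto
    also have "\<dots> = (\<Sum>v\<in>?V. gain_after \<P> G v)" using c by (intro sum.remove[symmetric]) auto
    finally have "Suc m * (2 + star_gain m) / ?n \<le> ?n * \<Q> G"
      unfolding card_mult_\<Q>[OF fin_digraph ne] by (rule divide_right_mono) simp
    moreover have "star_gain ?n = Suc m * (2 + star_gain m) / ?n"
      unfolding m by (simp add: algebra_simps)
    ultimately show ?thesis using P by simp
  qed
qed

lemma star_shaped_star: "0 < n \<Longrightarrow> star_shaped (star n) 0"
proof -
  assume n: "0 < n"
  have "wf_digraph (star n)" by unfold_locales (auto simp: star_def n)
  then have "fin_digraph (star n)"
    by (rule wf_digraph.fin_digraphI) (auto simp: star_def)
  moreover have "u \<rightarrow>\<^bsub>star n\<^esub> w \<longleftrightarrow> (u = 0) \<noteq> (w = 0)" if "u < n" "w < n" for u w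
    using that by (force simp: star_def arcs_ends_conv)
  ultimately show ?thesis using n by (simp add: star_shaped_def) (simp add: star_def)
qed

theorem theorem4p10:
  fixes T :: "('a, 'b) pre_digraph" and n :: nat
  assumes "undirected_tree T" and "card (verts T) = n"
  shows "\<P> T \<le> \<P> (star n) \<and> \<Q> T \<le> \<Q> (star n)"
proof -
  have T: "finite_tree T" using assms(1) by (rule undirected_tree_imp_finite_tree)
  interpret finite_tree T by fact
  have "verts T \<noteq> {}" using strongly_connected by (auto simp: strongly_connected_def)
  then have n: "0 < n" using assms(2) by (auto simp: card_gt_0_iff)
  have "card (verts (star n)) = n" by (simp add: star_def)
  then have "n * \<P> T \<le> n * \<P> (star n)" "n * \<Q> T \<le> n * \<Q> (star n)"
    using finite_tree_upper_bounds[OF T] star_shaped_lower_bounds[OF star_shaped_star[OF n]] assms(2)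
    by auto
  then show ?thesis using n by simp
qed

end
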